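(* Let $f_{abcd}$, $a,b,c,d\in\{1,\dots,D\}$, be totally antisymmetric real structure constants of a Nambu--Lie 3-algebra, and let $\tilde f^{abc}{}_{d}$ be totally antisymmetric dual structure constants, i.e. $\sum_{a,b,c}\tilde f^{abc}{}_{e}f_{abcd}=\delta_{ed}$. Assume that the underlying $(D-1)$-dimensional Lie algebra with structure constants $f_{ijk}:=f_{Dijk}$, $i,j,k\in\{1,\dots,D-1\}$, is semisimple. Let $T_1,\dots,T_D$ be complex $N\times N$ matrices ($N\ge1$) satisfying $$[T_a,T_b,T_c]_N=\mathrm{i}\sum_{d=1}^{D}f_{abcd}T_d\qquad\text{for all }a,b,c\in\{1,\dots,D\},$$ and suppose that $T_D=t_D\,\mathbb{I}$ with $t_D\in\mathbb{C}$, $t_D\ne0$, and that $T_1,\dots,T_{D-1}$ act irreducibly on $\mathbb{C}^N$. Put $\tau_i=t_DT_i$ for $i=1,\dots,D-1$. Then $$[\tau_i,\tau_j]=\mathrm{i}\sum_{k=1}^{D-1}f_{ijk}\tau_k\qquad\text{for all }i,j\in\{1,\dots,D-1\},$$ where $[\cdot,\cdot]$ is the usual matrix commutator, and $$t_D^4\,\mathbb{I}=3\sum_{i,j,k,l=1}^{D-1}\tilde f^{ijk}{}_{D}\,f_{jkl}\,\tau_i\tau_l .$$ In particular, if the right-hand side of the last equation is not a positive real multiple of $\mathbb{I}$, then the matrices $T_1,\dots,T_D$ are not all Hermitian.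
   Context: For square complex matrices $A,B,C$ of the same size, the Nambu commutator is $$[A,B,C]_N=ABC+BCA+CAB-BAC-ACB-CBA.$$ A (Euclidean) Nambu--Lie 3-algebra with generators $T_1,\dots,T_D$ in a basis where the metric is $\delta_{ab}$ is given by totally antisymmetric structure constants $f_{abcd}$, with bracket $[T_a,T_b,T_c]=\mathrm{i}\sum_d f_{abcd}T_d$, satisfying the Fundamental Identity (sum over $b$ understood) $$f_{a_1a_2ba}f_{a_3a_4a_5b}=f_{a_1a_2a_3b}f_{ba_4a_5a}+f_{a_1a_2a_4b}f_{a_3ba_5a}+f_{a_1a_2a_5b}f_{a_3a_4ba}.$$ Indices are raised and lowered with $\delta_{ab}$, so that "$\tilde f^{abc}{}_d$ totally antisymmetric" means antisymmetric in all four indices. The underlying Lie algebra is the one obtained by fixing the element $T_D$: its bracket is $[T_i,T_j]_{T_D}:=[T_D,T_i,T_j]$ and its structure constants are $f_{ijk}=f_{Dijk}$. "Act irreducibly" means there are no common invariant subspaces of $\mathbb{C}^N$ other than $0$ and $\mathbb{C}^N$. $\mathbb{I}$ is the identity matrix. *)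

theory Defs
  imports "HOL-Analysis.Analysis" "HOL-Analysis.Finite_Function_Topology"
begin

section \<open>Complex matrices\<close>

definition mat_scale :: "complex \<Rightarrow> complex^'n^'n \<Rightarrow> complex^'n^'n" (infixr "*\<^sub>M" 75)
  where "c *\<^sub>M A = map_matrix ((*) c) A"

definition nambu_commutator ::
  "complex^'n^'n \<Rightarrow> complex^'n^'n \<Rightarrow> complex^'n^'n \<Rightarrow> complex^'n^'n"
  where "nambu_commutator A B C =
    A ** B ** C + B ** C ** A + C ** A ** B - B ** A ** C - A ** C ** B - C ** B ** A"

definition hermitian_matrix :: "complex^'n^'n \<Rightarrow> bool"
  where "hermitian_matrix A \<longleftrightarrow> transpose (map_matrix cnj A) = A"

text \<open>Here \<^const>\<open>vec.subspace\<close> refers to complex linear subspaces, whereas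
  \<^const>\<open>subspace\<close> would only ask for closure under real scalars.\<close>

definition acts_irreducibly :: "(complex^'n^'n) set \<Rightarrow> bool"
  where "acts_irreducibly \<A> \<longleftrightarrow>
    (\<forall>V. vec.subspace V \<and> (\<forall>A\<in>\<A>. \<forall>v\<in>V. A *v v \<in> V) \<longrightarrow> V = {0} \<or> V = UNIV)"


section \<open>Lie algebras given by structure constants\<close>

text \<open>\<^term>\<open>c i j k\<close> is the coefficient of the \<open>k\<close>-th basis vector in the bracket of the
  \<open>i\<close>-th and the \<open>j\<close>-th one. The indices run over \<^term>\<open>{1..n}\<close>; the values of
  \<^term>\<open>c\<close> elsewhere are irrelevant. The underlying real vector space consists of the
  finitely supported functions with support in \<^term>\<open>{1..n}\<close>.\<close>

definition lie_structure :: "nat \<Rightarrow> (nat \<Rightarrow> nat \<Rightarrow> nat \<Rightarrow> real) \<Rightarrow> bool"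
  where "lie_structure n c \<longleftrightarrow>
    (\<forall>i\<in>{1..n}. \<forall>j\<in>{1..n}. \<forall>k\<in>{1..n}. c i j k = - c j i k) \<and>
    (\<forall>i\<in>{1..n}. \<forall>j\<in>{1..n}. \<forall>k\<in>{1..n}. \<forall>l\<in>{1..n}.
      (\<Sum>b=1..n. c j k b * c i b l + c k i b * c j b l + c i j b * c k b l) = 0)"

definition lie_space :: "nat \<Rightarrow> (nat \<Rightarrow>\<^sub>0 real) set"
  where "lie_space n = {x. Poly_Mapping.keys x \<subseteq> {1..n}}"

definition lie_bracket ::
  "nat \<Rightarrow> (nat \<Rightarrow> nat \<Rightarrow> nat \<Rightarrow> real) \<Rightarrow> (nat \<Rightarrow>\<^sub>0 real) \<Rightarrow> (nat \<Rightarrow>\<^sub>0 real) \<Rightarrow> (nat \<Rightarrow>\<^sub>0 real)"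
  where "lie_bracket n c x y = (\<Sum>i=1..n. \<Sum>j=1..n. \<Sum>k=1..n.
    Poly_Mapping.single k (Poly_Mapping.lookup x i * Poly_Mapping.lookup y j * c i j k))"

definition lie_ideal :: "nat \<Rightarrow> (nat \<Rightarrow> nat \<Rightarrow> nat \<Rightarrow> real) \<Rightarrow> (nat \<Rightarrow>\<^sub>0 real) set \<Rightarrow> bool"
  where "lie_ideal n c I \<longleftrightarrow>
    subspace I \<and> I \<subseteq> lie_space n \<and> (\<forall>x\<in>lie_space n. \<forall>y\<in>I. lie_bracket n c x y \<in> I)"

primrec derived_series ::
  "nat \<Rightarrow> (nat \<Rightarrow> nat \<Rightarrow> nat \<Rightarrow> real) \<Rightarrow> (nat \<Rightarrow>\<^sub>0 real) set \<Rightarrow> nat \<Rightarrow> (nat \<Rightarrow>\<^sub>0 real) set"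
  where
    "derived_series n c I 0 = I"
  | "derived_series n c I (Suc m) =
      span {lie_bracket n c x y |x y. x \<in> derived_series n c I m \<and> y \<in> derived_series n c I m}"

definition lie_solvable :: "nat \<Rightarrow> (nat \<Rightarrow> nat \<Rightarrow> nat \<Rightarrow> real) \<Rightarrow> (nat \<Rightarrow>\<^sub>0 real) set \<Rightarrow> bool"
  where "lie_solvable n c I \<longleftrightarrow> (\<exists>m. derived_series n c I m = {0})"

definition semisimple_lie :: "nat \<Rightarrow> (nat \<Rightarrow> nat \<Rightarrow> nat \<Rightarrow> real) \<Rightarrow> bool"
  where "semisimple_lie n c \<longleftrightarrow> lie_structure n c \<and>
    (\<forall>I. lie_ideal n c I \<and> lie_solvable n c I \<longrightarrow> I = {0})"


section \<open>Nambu--Lie 3-algebras\<close>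

definition totally_antisymmetric :: "nat \<Rightarrow> (nat \<Rightarrow> nat \<Rightarrow> nat \<Rightarrow> nat \<Rightarrow> real) \<Rightarrow> bool"
  where "totally_antisymmetric D f \<longleftrightarrow>
    (\<forall>a\<in>{1..D}. \<forall>b\<in>{1..D}. \<forall>c\<in>{1..D}. \<forall>d\<in>{1..D}.
      f b a c d = - f a b c d \<and> f c b a d = - f a b c d \<and> f d b c a = - f a b c d \<and>
      f a c b d = - f a b c d \<and> f a d c b = - f a b c d \<and> f a b d c = - f a b c d)"

definition fundamental_identity :: "nat \<Rightarrow> (nat \<Rightarrow> nat \<Rightarrow> nat \<Rightarrow> nat \<Rightarrow> real) \<Rightarrow> bool"
  where "fundamental_identity D f \<longleftrightarrow>
    (\<forall>a\<in>{1..D}. \<forall>a1\<in>{1..D}. \<forall>a2\<in>{1..D}. \<forall>a3\<in>{1..D}. \<forall>a4\<in>{1..D}. \<forall>a5\<in>{1..D}.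
      (\<Sum>b=1..D. f a1 a2 b a * f a3 a4 a5 b) =
      (\<Sum>b=1..D. f a1 a2 a3 b * f b a4 a5 a) +
      (\<Sum>b=1..D. f a1 a2 a4 b * f a3 b a5 a) +
      (\<Sum>b=1..D. f a1 a2 a5 b * f a3 a4 b a))"

definition nambu_lie_structure :: "nat \<Rightarrow> (nat \<Rightarrow> nat \<Rightarrow> nat \<Rightarrow> nat \<Rightarrow> real) \<Rightarrow> bool"
  where "nambu_lie_structure D f \<longleftrightarrow> totally_antisymmetric D f \<and> fundamental_identity D f"

text \<open>Fixing the element with index \<open>D\<close> does give a Lie algebra, so the first conjunct of
  \<^const>\<open>semisimple_lie\<close> is automatic in that case.\<close>

lemma lie_structure_of_nambu_lie:
  assumes "nambu_lie_structure D f"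
  shows "lie_structure (D - 1) (f D)"
proof (cases "D = 0")
  case True
  then show ?thesis by (simp add: lie_structure_def)
next
  case False
  have anti: "f a c b d = - f a b c d" "f b a c d = - f a b c d" "f d b c a = - f a b c d"
    "f c b a d = - f a b c d"
    if "a \<in> {1..D}" "b \<in> {1..D}" "c \<in> {1..D}" "d \<in> {1..D}" for a b c d
    using assms that unfolding nambu_lie_structure_def totally_antisymmetric_def by blast+
  have D: "D \<in> {1..D}" using False by simp
  have range: "{1..D} = insert D {1..D - 1}" "D \<notin> {1..D - 1}" using False by auto
  have drop: "(\<Sum>b=1..D. g b) = (\<Sum>b=1..D - 1. g b)" if "g D = 0" for g :: "nat \<Rightarrow> real"
    using that range by simp
  have zero: "f D i j D = 0" "f D i D j = 0" if "i \<in> {1..D}" "j \<in> {1..D}" for i j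
    using anti(3)[OF D that D] anti(4)[OF D that(1) D that(2)] by auto
  have jacobi: "(\<Sum>b=1..D - 1. f D j k b * f D i b l + f D k i b * f D j b l + f D i j b * f D k b l) = 0"
    if "i \<in> {1..D}" "j \<in> {1..D}" "k \<in> {1..D}" "l \<in> {1..D}" for i j k l
  proof -
    have "(\<Sum>b=1..D. f D i b l * f D j k b) =
      (\<Sum>b=1..D. f D i D b * f b j k l) + (\<Sum>b=1..D. f D i j b * f D b k l) +
      (\<Sum>b=1..D. f D i k b * f D j b l)"
      using assms that D unfolding nambu_lie_structure_def fundamental_identity_def by blast
    moreover have "(\<Sum>b=1..D. f D i D b * f b j k l) = 0"
      using zero that by (intro sum.neutral) simp
    moreover have "(\<Sum>b=1..D. f D i j b * f D b k l) = (\<Sum>b=1..D. - (f D i j b * f D k b l))"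
    proof (rule sum.cong)
      fix b assume "b \<in> {1..D}"
      then have "f D b k l = - f D k b l" using anti(1)[OF D that(3) _ that(4)] by blast
      then show "f D i j b * f D b k l = - (f D i j b * f D k b l)" by simp
    qed simp
    moreover have "(\<Sum>b=1..D. f D i k b * f D j b l) = (\<Sum>b=1..D. - (f D k i b * f D j b l))"
    proof (rule sum.cong)
      fix b assume "b \<in> {1..D}"
      then have "f D i k b = - f D k i b" using anti(1)[OF D that(3,1)] by blast
      then show "f D i k b * f D j b l = - (f D k i b * f D j b l)" by simp
    qed simp
    ultimately have
      "(\<Sum>b=1..D. f D j k b * f D i b l + f D k i b * f D j b l + f D i j b * f D k b l) = 0"
      by (simp add: sum.distrib sum_negf mult.commute)
    then show ?thesis
      using drop[of "\<lambda>b. f D j k b * f D i b l + f D k i b * f D j b l + f D i j b * f D k b l"]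
        zero(1)[OF that(1,2)] zero(1)[OF that(2,3)] zero(1)[OF that(3,1)] by simp
  qed
  have sub: "i \<in> {1..D}" if "i \<in> {1..D - 1}" for i using that by auto
  have "f D i j k = - f D j i k" if "i \<in> {1..D - 1}" "j \<in> {1..D - 1}" "k \<in> {1..D - 1}" for i j k
    using anti(1)[OF D sub[OF that(2)] sub[OF that(1)] sub[OF that(3)]] .
  then show ?thesis
    unfolding lie_structure_def using jacobi sub by blast
qed

definition dual_structure_constants ::
  "nat \<Rightarrow> (nat \<Rightarrow> nat \<Rightarrow> nat \<Rightarrow> nat \<Rightarrow> real) \<Rightarrow> (nat \<Rightarrow> nat \<Rightarrow> nat \<Rightarrow> nat \<Rightarrow> real) \<Rightarrow> bool"
  where "dual_structure_constants D f f' \<longleftrightarrow> totally_antisymmetric D f' \<and>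
    (\<forall>d\<in>{1..D}. \<forall>e\<in>{1..D}.
      (\<Sum>a=1..D. \<Sum>b=1..D. \<Sum>c=1..D. f' a b c e * f a b c d) = (if e = d then 1 else 0))"

end

(* Inserting the scalar matrix T_D into the Nambu commutator reduces it to t_D times the ordinary
   commutator, which gives the Lie algebra relations. Contracting the Nambu relations of the
   remaining generators with the dual structure constants with last index D leaves i t_D times
   the identity on the right; on the left the three cyclic terms T_i [T_j, T_k] contribute equally,
   and the Lie relations turn each into a quadratic expression in the generators. Finally, if T_D is
   Hermitian then t_D is real, so t_D^4 > 0. *)
theory Submission
  imports Defs
begin

lemma mat_scale_nth [simp]: "(c *\<^sub>M A) $ i $ j = c * A $ i $ j"
  by (simp add: mat_scale_def map_matrix_def)

lemma mat_scale_mat_scale [simp]: "a *\<^sub>M b *\<^sub>M A = (a * b) *\<^sub>M A"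
  by (simp add: vec_eq_iff)

lemma mat_scale_zero_left [simp]: "0 *\<^sub>M A = 0"
  by (simp add: vec_eq_iff)

lemma mat_scale_one [simp]: "1 *\<^sub>M A = A"
  by (simp add: vec_eq_iff)

lemma mat_scale_add_right: "a *\<^sub>M (A + B) = a *\<^sub>M A + a *\<^sub>M B"
  by (simp add: vec_eq_iff distrib_left)

lemma mat_scale_diff_right: "a *\<^sub>M (A - B) = a *\<^sub>M A - a *\<^sub>M B"
  by (simp add: vec_eq_iff right_diff_distrib)

lemma mat_scale_sum_right: "a *\<^sub>M (\<Sum>x\<in>S. A x) = (\<Sum>x\<in>S. a *\<^sub>M A x)"
  by (simp add: vec_eq_iff sum_distrib_left)

lemma mat_scale_sum_left: "(\<Sum>x\<in>S. a x) *\<^sub>M A = (\<Sum>x\<in>S. a x *\<^sub>M A)"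
  by (simp add: vec_eq_iff sum_distrib_right)

lemma mat_scale_mult_left [simp]: "(a *\<^sub>M A) ** B = a *\<^sub>M (A ** B)"
  by (simp add: vec_eq_iff matrix_matrix_mult_def sum_distrib_left mult.assoc)

lemma mat_scale_mult_right [simp]: "A ** (a *\<^sub>M B) = a *\<^sub>M (A ** B)"
  by (simp add: vec_eq_iff matrix_matrix_mult_def sum_distrib_left mult.left_commute)

lemma matrix_mult_sum_right: "A ** (\<Sum>x\<in>S. B x) = (\<Sum>x\<in>S. A ** (B x :: complex^'n^'n))"
  by (induction S rule: infinite_finite_induct) (simp_all add: matrix_add_ldistrib)

lemma matrix_mult_diff_right: "A ** (B - C) = A ** B - A ** (C :: complex^'n^'n)"
  by (simp add: vec_eq_iff matrix_matrix_mult_def right_diff_distrib sum_subtractf)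

text \<open>Once the scalar factor is pulled out, the six products become \<open>A ** B\<close> with
  signs +, +, - and \<open>B ** A\<close> with signs +, -, -, so one of each survives.\<close>

lemma nambu_commutator_scalar:
  "nambu_commutator (t *\<^sub>M mat 1) A B = t *\<^sub>M (A ** B - B ** A)"
  by (simp add: nambu_commutator_def mat_scale_diff_right)

text \<open>Grouping the six products by their leftmost factor exhibits ordinary commutators, to
  which the Lie relations can be applied.\<close>

lemma nambu_commutator_cyclic:
  "nambu_commutator A B C =
    A ** (B ** C - C ** B) + B ** (C ** A - A ** C) + C ** (A ** B - B ** A)"
  by (simp add: nambu_commutator_def matrix_mult_diff_right matrix_mul_assoc)

text \<open>Every diagonal entry of the matrix is \<open>t\<close>, and Hermitian symmetry makes it
  equal to its own conjugate.\<close>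

lemma hermitian_mat_scale_one_real:
  assumes "hermitian_matrix (t *\<^sub>M (mat 1 :: complex^'n^'n))"
  shows "t \<in> \<real>"
proof -
  have "transpose (map_matrix cnj (t *\<^sub>M mat 1)) $ i $ i = (t *\<^sub>M (mat 1 :: complex^'n^'n)) $ i $ i"
    for i
    using assms by (simp add: hermitian_matrix_def)
  then have "cnj t = t"
    by (simp add: transpose_def map_matrix_def mat_def)
  then show ?thesis
    by (simp add: Reals_cnj_iff)
qed

text \<open>A rotation of the arguments of \<open>G\<close> is absorbed by the weight, which is
  invariant under it; what remains is a renaming of summation indices.\<close>

lemma sum_cyclic_weight:
  assumes w: "\<And>i j k. i \<in> S \<Longrightarrow> j \<in> S \<Longrightarrow> k \<in> S \<Longrightarrow> w i j k = w j k i"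
  shows "(\<Sum>i\<in>S. \<Sum>j\<in>S. \<Sum>k\<in>S. w i j k *\<^sub>M G j k i) =
    (\<Sum>i\<in>S. \<Sum>j\<in>S. \<Sum>k\<in>S. w i j k *\<^sub>M G i j k)"
proof -
  have "(\<Sum>i\<in>S. \<Sum>j\<in>S. \<Sum>k\<in>S. w i j k *\<^sub>M G j k i) =
    (\<Sum>i\<in>S. \<Sum>j\<in>S. \<Sum>k\<in>S. w j k i *\<^sub>M G j k i)"
    by (intro sum.cong refl arg_cong[where f = "\<lambda>c. c *\<^sub>M _"] w)
  also have "\<dots> = (\<Sum>j\<in>S. \<Sum>i\<in>S. \<Sum>k\<in>S. w j k i *\<^sub>M G j k i)"
    by (rule sum.swap)
  also have "\<dots> = (\<Sum>j\<in>S. \<Sum>k\<in>S. \<Sum>i\<in>S. w j k i *\<^sub>M G j k i)"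
    by (rule sum.cong[OF refl], rule sum.swap)
  finally show ?thesis .
qed

text \<open>The three cyclic groups of the Nambu commutator are rotations of one another, so a
  cyclic weight gives them equal sums. This is the origin of the factor 3 in the quartic
  identity.\<close>

lemma sum_cyclic_weight_nambu_commutator:
  fixes T :: "'a \<Rightarrow> complex^'n^'n"
  assumes w: "\<And>i j k. i \<in> S \<Longrightarrow> j \<in> S \<Longrightarrow> k \<in> S \<Longrightarrow> w i j k = w j k i"
  shows "(\<Sum>i\<in>S. \<Sum>j\<in>S. \<Sum>k\<in>S. w i j k *\<^sub>M nambu_commutator (T i) (T j) (T k)) =
    3 *\<^sub>M (\<Sum>i\<in>S. \<Sum>j\<in>S. \<Sum>k\<in>S. w i j k *\<^sub>M (T i ** (T j ** T k - T k ** T j)))"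
proof -
  define G where "G i j k = T i ** (T j ** T k - T k ** T j)" for i j k
  have once: "(\<Sum>i\<in>S. \<Sum>j\<in>S. \<Sum>k\<in>S. w i j k *\<^sub>M G j k i) =
      (\<Sum>i\<in>S. \<Sum>j\<in>S. \<Sum>k\<in>S. w i j k *\<^sub>M G i j k)"
    using w by (rule sum_cyclic_weight)
  \<comment> \<open>The same rotation, applied to the already rotated \<open>G\<close>, handles the
    third group.\<close>
  have "(\<Sum>i\<in>S. \<Sum>j\<in>S. \<Sum>k\<in>S. w i j k *\<^sub>M G k i j) =
      (\<Sum>i\<in>S. \<Sum>j\<in>S. \<Sum>k\<in>S. w i j k *\<^sub>M G j k i)"
    using sum_cyclic_weight[of S w "\<lambda>i j k. G j k i"] w by blast
  with once have "(\<Sum>i\<in>S. \<Sum>j\<in>S. \<Sum>k\<in>S. w i j k *\<^sub>M (G i j k + G j k i + G k i j)) =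
      (\<Sum>i\<in>S. \<Sum>j\<in>S. \<Sum>k\<in>S. w i j k *\<^sub>M G i j k) +
      (\<Sum>i\<in>S. \<Sum>j\<in>S. \<Sum>k\<in>S. w i j k *\<^sub>M G i j k) +
      (\<Sum>i\<in>S. \<Sum>j\<in>S. \<Sum>k\<in>S. w i j k *\<^sub>M G i j k)"
    by (simp only: mat_scale_add_right sum.distrib)
  moreover have "A + A + A = 3 *\<^sub>M A" for A :: "complex^'n^'n"
    by (simp add: vec_eq_iff)
  ultimately show ?thesis
    by (simp add: nambu_commutator_cyclic G_def)
qed

text \<open>For \<open>D = 0\<close> truncated subtraction makes both ranges the same empty
  set.\<close>

lemma sum_drop_last:
  fixes g :: "nat \<Rightarrow> 'a::comm_monoid_add"
  assumes "g D = 0"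
  shows "(\<Sum>b=1..D. g b) = (\<Sum>b=1..D - 1. g b)"
proof (cases D)
  case (Suc m)
  then show ?thesis
    using assms by simp
qed simp

text \<open>Swapping the two equal indices changes the sign of the value, which is therefore zero.
  These cases remove the index \<open>D\<close> from sums.\<close>

lemma totally_antisymmetric_last_zero:
  assumes "totally_antisymmetric D f" "D \<in> {1..D}" "a \<in> {1..D}" "b \<in> {1..D}"
  shows "f D a b D = 0" "f a D b D = 0" "f a b D D = 0"
proof -
  have "f D a b D = - f D a b D" "f a D b D = - f a D b D" "f a b D D = - f a b D D"
    using assms unfolding totally_antisymmetric_def by blast+
  then show "f D a b D = 0" "f a D b D = 0" "f a b D D = 0"
    by simp_all
qed

text \<open>A 3-cycle is a product of two transpositions, whose signs cancel.\<close>

lemma totally_antisymmetric_cyclic: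
  assumes "totally_antisymmetric D f" "a \<in> {1..D}" "b \<in> {1..D}" "c \<in> {1..D}" "d \<in> {1..D}"
  shows "f a b c d = f b c a d"
proof -
  have "f b a c d = - f a b c d" "f b c a d = - f b a c d"
    using assms unfolding totally_antisymmetric_def by blast+
  then show ?thesis
    by simp
qed

text \<open>After inserting the Nambu relations and moving the sum over \<open>d\<close> outermost,
  the coefficient of \<open>T d\<close> is the dual contraction, a Kronecker delta times the
  imaginary unit.\<close>

lemma dual_contraction_nambu:
  assumes dual: "dual_structure_constants D f f'" and e: "e \<in> {1..D}"
    and rel: "\<And>a b c. a \<in> {1..D} \<Longrightarrow> b \<in> {1..D} \<Longrightarrow> c \<in> {1..D} \<Longrightarrow>
      nambu_commutator (T a) (T b) (T c) = \<i> *\<^sub>M (\<Sum>d=1..D. complex_of_real (f a b c d) *\<^sub>M T d)"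
  shows "(\<Sum>a=1..D. \<Sum>b=1..D. \<Sum>c=1..D.
      complex_of_real (f' a b c e) *\<^sub>M nambu_commutator (T a) (T b) (T c)) = \<i> *\<^sub>M T e"
proof -
  let ?S = "{1..D}"
  let ?h = "\<lambda>a b c d. (\<i> * complex_of_real (f' a b c e * f a b c d)) *\<^sub>M T d"
  have "(\<Sum>a\<in>?S. \<Sum>b\<in>?S. \<Sum>c\<in>?S.
      complex_of_real (f' a b c e) *\<^sub>M nambu_commutator (T a) (T b) (T c)) =
      (\<Sum>a\<in>?S. \<Sum>b\<in>?S. \<Sum>c\<in>?S. \<Sum>d\<in>?S. ?h a b c d)"
    by (intro sum.cong refl) (simp add: rel mat_scale_sum_right mult_ac)
  also have "\<dots> = (\<Sum>a\<in>?S. \<Sum>b\<in>?S. \<Sum>d\<in>?S. \<Sum>c\<in>?S. ?h a b c d)"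
    by (rule sum.cong[OF refl], rule sum.cong[OF refl], rule sum.swap)
  also have "\<dots> = (\<Sum>a\<in>?S. \<Sum>d\<in>?S. \<Sum>b\<in>?S. \<Sum>c\<in>?S. ?h a b c d)"
    by (rule sum.cong[OF refl], rule sum.swap)
  also have "\<dots> = (\<Sum>d\<in>?S. \<Sum>a\<in>?S. \<Sum>b\<in>?S. \<Sum>c\<in>?S. ?h a b c d)"
    by (rule sum.swap)
  also have "\<dots> = (\<Sum>d\<in>?S.
      (\<i> * complex_of_real (\<Sum>a\<in>?S. \<Sum>b\<in>?S. \<Sum>c\<in>?S. f' a b c e * f a b c d)) *\<^sub>M T d)"
    by (simp only: of_real_sum sum_distrib_left mat_scale_sum_left)
  also have "\<dots> = (\<Sum>d\<in>?S. if e = d then \<i> *\<^sub>M T d else 0)"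
    using dual e by (intro sum.cong refl) (simp add: dual_structure_constants_def)
  also have "\<dots> = \<i> *\<^sub>M T e"
    using e by (simp only: sum.delta' finite_atLeastAtMost if_True)
  finally show ?thesis .
qed

theorem mainTheorem2:
  fixes D :: nat
    and f f' :: "nat \<Rightarrow> nat \<Rightarrow> nat \<Rightarrow> nat \<Rightarrow> real"
    and T \<tau> :: "nat \<Rightarrow> complex^'n^'n"
    and t :: complex
  assumes "D \<ge> 1"
    and "nambu_lie_structure D f"
    and "dual_structure_constants D f f'"
    and "semisimple_lie (D - 1) (\<lambda>i j k. f D i j k)"
    and "\<And>a b c. a \<in> {1..D} \<Longrightarrow> b \<in> {1..D} \<Longrightarrow> c \<in> {1..D} \<Longrightarrow>
      nambu_commutator (T a) (T b) (T c) = \<i> *\<^sub>M (\<Sum>d=1..D. complex_of_real (f a b c d) *\<^sub>M T d)"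
    and "T D = t *\<^sub>M mat 1"
    and "t \<noteq> 0"
    and "acts_irreducibly (T ` {1..D - 1})"
    and "\<And>i. i \<in> {1..D - 1} \<Longrightarrow> \<tau> i = t *\<^sub>M T i"
  shows "let R = 3 *\<^sub>M (\<Sum>i=1..D - 1. \<Sum>j=1..D - 1. \<Sum>k=1..D - 1. \<Sum>l=1..D - 1.
                complex_of_real (f' i j k D * f D j k l) *\<^sub>M (\<tau> i ** \<tau> l))
    in (\<forall>i\<in>{1..D - 1}. \<forall>j\<in>{1..D - 1}.
          \<tau> i ** \<tau> j - \<tau> j ** \<tau> i = \<i> *\<^sub>M (\<Sum>k=1..D - 1. complex_of_real (f D i j k) *\<^sub>M \<tau> k))
     \<and> t ^ 4 *\<^sub>M mat 1 = R
     \<and> ((\<nexists>r::real. r > 0 \<and> R = complex_of_real r *\<^sub>M mat 1) \<longrightarrow>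
          \<not> (\<forall>a\<in>{1..D}. hermitian_matrix (T a)))"
proof -
  note rel = assms(5) and TD = assms(6) and t = assms(7) and \<tau> = assms(9)
  have D: "D \<in> {1..D}"
    using assms(1) by simp
  have sub: "i \<in> {1..D}" if "i \<in> {1..D - 1}" for i
    using that by auto
  have anti: "totally_antisymmetric D f" "totally_antisymmetric D f'"
    using assms(2,3) by (simp_all add: nambu_lie_structure_def dual_structure_constants_def)

  have comm: "t *\<^sub>M (T i ** T j - T j ** T i) =
      \<i> *\<^sub>M (\<Sum>k=1..D - 1. complex_of_real (f D i j k) *\<^sub>M T k)"
    if "i \<in> {1..D - 1}" "j \<in> {1..D - 1}" for i j
  proof -
    \<comment> \<open>This is the Nambu relation with the scalar matrix \<open>T D\<close> in the
      first slot.\<close>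
    have "t *\<^sub>M (T i ** T j - T j ** T i) =
        \<i> *\<^sub>M (\<Sum>k=1..D. complex_of_real (f D i j k) *\<^sub>M T k)"
      using rel[OF D sub[OF that(1)] sub[OF that(2)]] by (simp add: TD nambu_commutator_scalar)
    also have "(\<Sum>k=1..D. complex_of_real (f D i j k) *\<^sub>M T k) =
        (\<Sum>k=1..D - 1. complex_of_real (f D i j k) *\<^sub>M T k)"
      using totally_antisymmetric_last_zero(1)[OF anti(1) D sub sub] that
      by (intro sum_drop_last) simp
    finally show ?thesis .
  qed

  have lie: "\<tau> i ** \<tau> j - \<tau> j ** \<tau> i =
      \<i> *\<^sub>M (\<Sum>k=1..D - 1. complex_of_real (f D i j k) *\<^sub>M \<tau> k)"
    if "i \<in> {1..D - 1}" "j \<in> {1..D - 1}" for i j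
  proof -
    \<comment> \<open>One factor \<open>t\<close> is used up by \<open>comm\<close>; the other turns
      each \<open>T k\<close> on the right into \<open>\<tau> k\<close>.\<close>
    have "\<tau> i ** \<tau> j - \<tau> j ** \<tau> i = t *\<^sub>M (t *\<^sub>M (T i ** T j - T j ** T i))"
      using that by (simp add: \<tau> mat_scale_diff_right)
    also have "\<dots> = \<i> *\<^sub>M (\<Sum>k=1..D - 1. complex_of_real (f D i j k) *\<^sub>M \<tau> k)"
      unfolding comm[OF that] by (simp add: \<tau> mat_scale_sum_right mult_ac)
    finally show ?thesis .
  qed

  let ?S = "{1..D - 1}"
  let ?w = "\<lambda>i j k. complex_of_real (f' i j k D)"
  let ?N = "\<lambda>i j k. ?w i j k *\<^sub>M nambu_commutator (T i) (T j) (T k)"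
  let ?Q = "\<Sum>i\<in>?S. \<Sum>j\<in>?S. \<Sum>k\<in>?S. \<Sum>l\<in>?S.
    complex_of_real (f' i j k D * f D j k l) *\<^sub>M (\<tau> i ** \<tau> l)"
  note zero = totally_antisymmetric_last_zero[OF anti(2) D]
  have "\<i> *\<^sub>M T D = (\<Sum>i=1..D. \<Sum>j=1..D. \<Sum>k=1..D. ?N i j k)"
    using dual_contraction_nambu[OF assms(3) D rel] by simp
  \<comment> \<open>The value \<open>D\<close> is removed from the three sums, innermost first: the
    last index of \<open>f'\<close> is already \<open>D\<close>, so a second \<open>D\<close> gives
    zero.\<close>
  also have "\<dots> = (\<Sum>i=1..D. \<Sum>j=1..D. \<Sum>k\<in>?S. ?N i j k)"
    by (rule sum.cong[OF refl], rule sum.cong[OF refl], rule sum_drop_last) (simp add: zero)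
  also have "\<dots> = (\<Sum>i=1..D. \<Sum>j\<in>?S. \<Sum>k\<in>?S. ?N i j k)"
    by (rule sum.cong[OF refl], rule sum_drop_last, intro sum.neutral ballI)
      (simp only: zero sub of_real_0 mat_scale_zero_left)
  also have "\<dots> = (\<Sum>i\<in>?S. \<Sum>j\<in>?S. \<Sum>k\<in>?S. ?N i j k)"
    by (rule sum_drop_last, intro sum.neutral ballI)
      (simp only: zero sub of_real_0 mat_scale_zero_left)
  also have "\<dots> = 3 *\<^sub>M (\<Sum>i\<in>?S. \<Sum>j\<in>?S. \<Sum>k\<in>?S.
      ?w i j k *\<^sub>M (T i ** (T j ** T k - T k ** T j)))"
    using totally_antisymmetric_cyclic[OF anti(2) sub sub sub D]
    by (intro sum_cyclic_weight_nambu_commutator) simp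
  \<comment> \<open>The cube supplies one \<open>t\<close> for each of the three generators in every
    product.\<close>
  finally have "t ^ 3 *\<^sub>M (\<i> *\<^sub>M T D) =
      t ^ 3 *\<^sub>M (3 *\<^sub>M (\<Sum>i\<in>?S. \<Sum>j\<in>?S. \<Sum>k\<in>?S.
        ?w i j k *\<^sub>M (T i ** (T j ** T k - T k ** T j))))"
    by (rule arg_cong)
  also have "\<dots> = 3 *\<^sub>M (\<Sum>i\<in>?S. \<Sum>j\<in>?S. \<Sum>k\<in>?S.
      ?w i j k *\<^sub>M (\<tau> i ** (\<tau> j ** \<tau> k - \<tau> k ** \<tau> j)))"
    unfolding mat_scale_sum_right
    by (intro sum.cong refl)
      (simp add: \<tau> matrix_mult_diff_right mat_scale_diff_right power3_eq_cube mult_ac)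
  \<comment> \<open>Here \<open>lie\<close> replaces the inner commutator by a linear combination of
    the \<open>\<tau> l\<close>, lowering the degree from three to two.\<close>
  also have "\<dots> = \<i> *\<^sub>M (3 *\<^sub>M ?Q)"
    unfolding mat_scale_sum_right
    by (intro sum.cong refl)
      (simp add: lie matrix_mult_sum_right mat_scale_sum_right mult_ac)
  \<comment> \<open>Multiplying by \<open>- \<i>\<close> cancels the imaginary unit on both sides.
    The fourth power of \<open>t\<close> then arises from the cube and the scalar in
    \<open>T D\<close>.\<close>
  finally have "(- \<i>) *\<^sub>M (t ^ 3 *\<^sub>M (\<i> *\<^sub>M T D)) = (- \<i>) *\<^sub>M (\<i> *\<^sub>M (3 *\<^sub>M ?Q))"
    by (rule arg_cong)
  then have quartic: "t ^ 4 *\<^sub>M mat 1 = 3 *\<^sub>M ?Q"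
    by (simp add: TD eval_nat_numeral mult_ac)

  \<comment> \<open>This is the contrapositive of the last claim. The witness is
    \<open>x ^ 4\<close> for the real value \<open>x\<close> of \<open>t\<close>, positive since the
    exponent is even and \<open>t\<close> is nonzero.\<close>
  have "\<exists>r::real. r > 0 \<and> 3 *\<^sub>M ?Q = complex_of_real r *\<^sub>M mat 1"
    if "\<forall>a\<in>{1..D}. hermitian_matrix (T a)"
  proof -
    have "hermitian_matrix (t *\<^sub>M (mat 1 :: complex^'n^'n))"
      using bspec[OF that D] TD by simp
    then obtain x where x: "t = complex_of_real x"
      using hermitian_mat_scale_one_real by (blast elim: Reals_cases)
    then have "x ^ 4 > 0" "3 *\<^sub>M ?Q = complex_of_real (x ^ 4) *\<^sub>M mat 1"
      using t quartic by (simp_all add: zero_less_power_eq)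
    then show ?thesis
      by blast
  qed
  with lie quartic show ?thesis
    unfolding Let_def by blast
qed

end
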